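(* Every Any Fit algorithm is absolutely $3$-competitive for Black and White Bin Packing: on every input sequence $L$ it uses at most $3\cdot\mathrm{OPT}(L)$ bins.
   Context: Black and White Bin Packing: items arrive as a sequence; each item has a size in $[0,1]$ and a color that is either black or white. A packing places items into unit-capacity bins, items in a bin ordered by arrival; it is valid if each bin has total size at most $1$ and the colors of consecutive items in each bin alternate (no two consecutive items in a bin have the same color). $\mathrm{OPT}(L)$ is the minimum number of bins in a valid packing of $L$ without reordering. An Any Fit algorithm is an online algorithm that packs each incoming item into some already existing bin whenever there is a bin into which it can be validly added (the choice among such bins is arbitrary and depends on the algorithm), and opens a new bin only when there is no such bin. *)

theory Defs
  imports Complex_Main
begin

datatype color = Black | White

datatype item = Item (item_size: real) (item_color: color)

definition is_input :: "item list \<Rightarrow> bool" where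
  "is_input L \<longleftrightarrow> (\<forall>x \<in> set L. 0 \<le> item_size x \<and> item_size x \<le> 1)"

text \<open>The list lists the items of a bin in order of arrival.\<close>

definition valid_bin :: "item list \<Rightarrow> bool" where
  "valid_bin xs \<longleftrightarrow>
     sum_list (map item_size xs) \<le> 1 \<and>
     successively (\<lambda>x y. item_color x \<noteq> item_color y) xs"

text \<open>A packing of \<open>L\<close> is the list \<open>p\<close> of bin labels assigned to the items of \<open>L\<close>, position by
  position. The labels are arbitrary natural numbers, and the bins used are the elements of
  \<open>set p\<close>, so a bin exists only once it has received an item.\<close>

definition bin_items :: "item list \<Rightarrow> nat list \<Rightarrow> nat \<Rightarrow> item list" where
  "bin_items L p b = map fst (filter (\<lambda>(x, c). c = b) (zip L p))"

definition valid_packing :: "item list \<Rightarrow> nat list \<Rightarrow> bool" where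
  "valid_packing L p \<longleftrightarrow> length p = length L \<and> (\<forall>b \<in> set p. valid_bin (bin_items L p b))"

definition num_bins :: "nat list \<Rightarrow> nat" where
  "num_bins p = card (set p)"

definition OPT :: "item list \<Rightarrow> nat" where
  "OPT L = (LEAST m. \<exists>p. valid_packing L p \<and> num_bins p = m)"

text \<open>An online algorithm maps the nonempty sequence of items that have arrived so far to the bin
  that receives the last of them. Its earlier decisions are determined by the shorter prefixes,
  so they need not be passed as an argument.\<close>

type_synonym online_algorithm = "item list \<Rightarrow> nat"

definition run :: "online_algorithm \<Rightarrow> item list \<Rightarrow> nat list" where
  "run A L = map (\<lambda>i. A (take (Suc i) L)) [0..<length L]"

definition can_add :: "item list \<Rightarrow> nat list \<Rightarrow> item \<Rightarrow> nat \<Rightarrow> bool" where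
  "can_add L p x b \<longleftrightarrow> valid_bin (bin_items L p b @ [x])"

definition any_fit :: "online_algorithm \<Rightarrow> bool" where
  "any_fit A \<longleftrightarrow>
     (\<forall>L x. is_input (L @ [x]) \<longrightarrow>
        (let p = run A L; b = A (L @ [x]) in
           if \<exists>b' \<in> set p. can_add L p x b'
           then b \<in> set p \<and> can_add L p x b
           else b \<notin> set p))"

definition absolutely_competitive :: "real \<Rightarrow> online_algorithm \<Rightarrow> bool" where
  "absolutely_competitive r A \<longleftrightarrow>
     (\<forall>L. is_input L \<longrightarrow> real (num_bins (run A L)) \<le> r * real (OPT L))"

lemma length_run [simp]: "length (run A L) = length L"
  by (simp add: run_def)

lemma run_Nil [simp]: "run A [] = []"
  by (simp add: run_def)

lemma run_snoc [simp]: "run A (L @ [x]) = run A L @ [A (L @ [x])]"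
  by (simp add: run_def)

lemma bin_items_snoc:
  "length p = length L \<Longrightarrow>
   bin_items (L @ [x]) (p @ [c]) b = bin_items L p b @ (if c = b then [x] else [])"
  by (simp add: bin_items_def)

lemma bin_items_unused: "b \<notin> set p \<Longrightarrow> bin_items L p b = []"
  by (auto simp: bin_items_def filter_empty_conv dest: set_zip_rightD)

lemma any_fit_valid_packing:
  assumes "any_fit A" "is_input L"
  shows "valid_packing L (run A L)"
  using assms(2)
proof (induction L rule: rev_induct)
  case Nil
  show ?case by (simp add: valid_packing_def)
next
  case (snoc x L)
  define b where "b = A (L @ [x])"
  have v: "valid_packing L (run A L)"
    using snoc by (auto simp: is_input_def)
  have x1: "item_size x \<le> 1"
    using snoc.prems by (simp add: is_input_def)
  have "b \<in> set (run A L) \<and> can_add L (run A L) x b \<or> b \<notin> set (run A L)"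
    using assms(1) snoc.prems unfolding any_fit_def Let_def b_def by meson
  then have "valid_bin (bin_items L (run A L) b @ [x])"
    using x1 by (auto simp: can_add_def bin_items_unused valid_bin_def)
  then show ?case
    using v by (auto simp: valid_packing_def bin_items_snoc b_def)
qed

lemma ex_any_fit: "\<exists>A. any_fit A"
proof -
  define good where "good L x p b \<longleftrightarrow>
    (if \<exists>b' \<in> set p. can_add L p x b' then b \<in> set p \<and> can_add L p x b else b \<notin> set p)"
    for L x p b
  have ex: "\<exists>b. good L x p b" for L x p
    unfolding good_def using ex_new_if_finite[OF infinite_UNIV_nat, of "set p"] by auto
  define P where "P = rec_nat (\<lambda>L. [])
    (\<lambda>n f L. let p = f (butlast L) in p @ [SOME b. good (butlast L) (last L) p b])"
  define A where "A L = last (P (length L) L)" for L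
  have PS: "P (Suc n) L = P n (butlast L) @ [SOME b. good (butlast L) (last L) (P n (butlast L)) b]"
    for n L by (simp add: P_def Let_def)
  have run: "run A L = P (length L) L" for L
  proof (induction L rule: rev_induct)
    case (snoc x L)
    then show ?case by (simp add: PS A_def)
  qed (simp add: P_def)
  have "good L x (run A L) (A (L @ [x]))" for L x
    using someI_ex[OF ex[of L x "run A L"]] by (simp add: A_def PS run)
  then show ?thesis
    unfolding any_fit_def Let_def good_def by blast
qed

lemma OPT_attained:
  assumes "is_input L"
  shows "\<exists>p. valid_packing L p \<and> num_bins p = OPT L"
proof -
  obtain A where "any_fit A" using ex_any_fit by blast
  then have "\<exists>m p. valid_packing L p \<and> num_bins p = m"
    using any_fit_valid_packing assms by blast
  then show ?thesis unfolding OPT_def by (rule LeastI_ex)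
qed

end

theory Submission
  imports Defs "HOL-Analysis.Henstock_Kurzweil_Integration"
begin

text \<open>Fix \<open>t \<le> 1/2\<close> and call an Any Fit bin light if its final load is at most \<open>t\<close>. An item of a
  light bin fits by size into every bin of final load at most \<open>1 - t\<close>, so when it opens a bin, all
  those bins have its color on top. Therefore the number of light bins with color \<open>c\<close> on top, minus
  the number of other bins with the other color on top, grows by at most one with each item of
  color \<open>c\<close> and, while positive, decreases with every other item. It is thus bounded by the excess
  of color \<open>c\<close> on some suffix of the input, which forces as many bins in any packing. It follows
  that there are at most \<open>OPT\<close> more bins of load at most \<open>t\<close> than bins of load above \<open>1 - t\<close>.
  Integrating over \<open>t \<in> [0, 1/2]\<close> bounds the number of bins by twice the total size plus \<open>OPT\<close>,
  and the total size is at most \<open>OPT\<close>.\<close>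

section \<open>Bin loads\<close>

abbreviation total_size :: "item list \<Rightarrow> real" where
  "total_size xs \<equiv> sum_list (map item_size xs)"

definition bin_load :: "item list \<Rightarrow> nat list \<Rightarrow> nat \<Rightarrow> real" where
  "bin_load L p b = total_size (bin_items L p b)"

lemma bin_load_snoc:
  "length p = length L \<Longrightarrow>
   bin_load (L @ [x]) (p @ [c]) b = bin_load L p b + (if c = b then item_size x else 0)"
  by (simp add: bin_load_def bin_items_snoc)

lemma set_bin_items_subset: "set (bin_items L p b) \<subseteq> set L"
  by (auto simp: bin_items_def dest: set_zip_leftD)

lemma bin_load_nonneg: "is_input L \<Longrightarrow> 0 \<le> bin_load L p b"
  using set_bin_items_subset by (fastforce simp: bin_load_def is_input_def intro!: sum_list_nonneg)

lemma bin_items_append: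
  "length p = length L \<Longrightarrow> bin_items (L @ L') (p @ p') b = bin_items L p b @ bin_items L' p' b"
  by (simp add: bin_items_def)

lemma bin_load_take_le:
  assumes "is_input L" "length p = length L"
  shows "bin_load (take n L) (take n p) b \<le> bin_load L p b"
proof -
  have "is_input (drop n L)"
    using assms(1) by (auto simp: is_input_def dest: in_set_dropD)
  moreover have "bin_load L p b = bin_load (take n L) (take n p) b + bin_load (drop n L) (drop n p) b"
    using bin_items_append[of "take n p" "take n L" "drop n L" "drop n p" b] assms(2)
    by (simp add: bin_load_def)
  ultimately show ?thesis by (simp add: bin_load_nonneg)
qed

lemma item_size_le_bin_load:
  assumes "is_input L" "length p = length L" "i < length L"
  shows "item_size (L ! i) \<le> bin_load L p (p ! i)"
proof -
  have "is_input (take i L)"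
    using assms(1) by (auto simp: is_input_def dest: in_set_takeD)
  then have "item_size (L ! i) \<le> bin_load (take (Suc i) L) (take (Suc i) p) (p ! i)"
    using assms(2,3) by (simp add: take_Suc_conv_app_nth bin_load_snoc bin_load_nonneg)
  also have "\<dots> \<le> bin_load L p (p ! i)"
    using assms(1,2) by (rule bin_load_take_le)
  finally show ?thesis .
qed

lemma sum_bin_load:
  assumes "length p = length L" "finite B" "set p \<subseteq> B"
  shows "(\<Sum>b\<in>B. bin_load L p b) = total_size L"
  using assms
proof (induction p L rule: rev_induct2[case_names Nil_Nil snoc_Nil Nil_snoc snoc_snoc])
  case Nil_Nil
  then show ?case by (simp add: bin_load_def bin_items_def)
next
  case (snoc_snoc b p x L)
  then show ?case by (simp add: bin_load_snoc sum.distrib)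
qed auto

lemma total_size_le_num_bins:
  assumes "valid_packing L p"
  shows "total_size L \<le> num_bins p"
proof -
  have "total_size L = (\<Sum>b\<in>set p. bin_load L p b)"
    using assms by (simp add: sum_bin_load valid_packing_def)
  also have "\<dots> \<le> (\<Sum>b\<in>set p. 1)"
    using assms by (intro sum_mono) (auto simp: valid_packing_def valid_bin_def bin_load_def)
  finally show ?thesis by (simp add: num_bins_def)
qed

section \<open>Colors on top\<close>

definition bins_topped :: "item list \<Rightarrow> nat list \<Rightarrow> color \<Rightarrow> nat set" where
  "bins_topped L p c = {b \<in> set p. item_color (last (bin_items L p b)) = c}"

lemma bins_topped_subset: "bins_topped L p c \<subseteq> set p"
  by (auto simp: bins_topped_def)

lemma finite_bins_topped [simp]: "finite (bins_topped L p c)"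
  by (simp add: bins_topped_def)

lemma bins_topped_snoc:
  "length p = length L \<Longrightarrow>
   bins_topped (L @ [x]) (p @ [b]) c =
     (if item_color x = c then insert b (bins_topped L p c) else bins_topped L p c - {b})"
  by (auto simp: bins_topped_def bin_items_snoc)

lemma bins_topped_Un_bins_topped:
  assumes "c \<noteq> c'"
  shows "bins_topped L p c \<union> bins_topped L p c' = set p"
proof -
  have "d = c \<or> d = c'" for d
    using assms by (metis color.exhaust)
  then show ?thesis by (auto simp: bins_topped_def)
qed

inductive alternating_packing :: "item list \<Rightarrow> nat list \<Rightarrow> bool" where
  Nil: "alternating_packing [] []"
| snoc: "alternating_packing L p \<Longrightarrow> b \<notin> bins_topped L p (item_color x) \<Longrightarrow>
    alternating_packing (L @ [x]) (p @ [b])"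

inductive_cases alternating_packing_snocE: "alternating_packing (L @ [x]) q"

lemma alternating_packing_length: "alternating_packing L p \<Longrightarrow> length p = length L"
  by (induction rule: alternating_packing.induct) simp_all

lemma bin_items_eq_Nil_iff:
  assumes "length p = length L"
  shows "bin_items L p b = [] \<longleftrightarrow> b \<notin> set p"
  using assms by (induction p L rule: list_induct2) (auto simp: bin_items_def)

lemma alternating_packingI:
  assumes "length p = length L"
    and "\<And>b. successively (\<lambda>x y. item_color x \<noteq> item_color y) (bin_items L p b)"
  shows "alternating_packing L p"
  using assms
proof (induction p L rule: rev_induct2[case_names Nil_Nil snoc_Nil Nil_snoc snoc_snoc])
  case (snoc_snoc b p x L)
  have len: "length p = length L" using snoc_snoc.prems(1) by simp
  show ?case
  proof (rule alternating_packing.snoc)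
    show "alternating_packing L p"
      using snoc_snoc len by (auto simp: bin_items_append successively_append_iff)
    show "b \<notin> bins_topped L p (item_color x)"
      using snoc_snoc.prems(2)[of b] len
      by (auto simp: bin_items_snoc bins_topped_def successively_append_iff bin_items_eq_Nil_iff)
  qed
qed (auto intro: alternating_packing.Nil)

lemma valid_packing_imp_alternating:
  assumes "valid_packing L p"
  shows "alternating_packing L p"
proof (rule alternating_packingI)
  show "length p = length L" using assms by (simp add: valid_packing_def)
  show "successively (\<lambda>x y. item_color x \<noteq> item_color y) (bin_items L p b)" for b
    using assms
    by (cases "b \<in> set p") (auto simp: valid_packing_def valid_bin_def bin_items_unused)
qed

text \<open>The largest excess, over all suffixes of \<open>L\<close>, of the items of color \<open>c\<close> over the others.\<close>

definition surplus :: "color \<Rightarrow> item list \<Rightarrow> nat" where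
  "surplus c L = fold (\<lambda>x n. if item_color x = c then Suc n else n - 1) L 0"

lemma surplus_Nil [simp]: "surplus c [] = 0"
  by (simp add: surplus_def)

lemma surplus_snoc [simp]:
  "surplus c (L @ [x]) = (if item_color x = c then Suc (surplus c L) else surplus c L - 1)"
  by (simp add: surplus_def)

lemma surplus_le_card_bins_topped:
  "alternating_packing L p \<Longrightarrow> surplus c L \<le> card (bins_topped L p c)"
proof (induction rule: alternating_packing.induct)
  case (snoc L p b x)
  then show ?case
    by (auto simp: bins_topped_snoc alternating_packing_length card_Diff_singleton_if)
qed simp

lemma surplus_le_num_bins:
  assumes "alternating_packing L p"
  shows "surplus c L \<le> num_bins p"
proof -
  have "surplus c L \<le> card (bins_topped L p c)"
    using assms by (rule surplus_le_card_bins_topped)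
  also have "\<dots> \<le> num_bins p"
    by (simp add: num_bins_def card_mono bins_topped_subset)
  finally show ?thesis .
qed

section \<open>Monochromatic openings\<close>

text \<open>The truncation matters: when a bin of \<open>K\<close> is opened, the untruncated difference for the other
  color need not decrease, but it is then at most 0.\<close>

definition topped_excess :: "nat set \<Rightarrow> item list \<Rightarrow> nat list \<Rightarrow> color \<Rightarrow> nat" where
  "topped_excess K L p c =
     card (bins_topped L p c \<inter> K) - card (set p - bins_topped L p c - K)"

lemma card_Int_le_topped_excess:
  assumes "set p \<inter> S \<subseteq> bins_topped L p c" "K \<subseteq> S"
  shows "card (set p \<inter> K) \<le> topped_excess K L p c + card (set p - S)"
proof -
  have "card (set p \<inter> K) \<le> card (bins_topped L p c \<inter> K)"
    using assms by (intro card_mono) auto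
  moreover have "card (set p - bins_topped L p c - K) \<le> card (set p - S)"
    using assms by (intro card_mono) auto
  ultimately show ?thesis by (simp add: topped_excess_def)
qed

lemma topped_excess_snoc_same_color:
  assumes "length p = length L" "b \<notin> bins_topped L p (item_color x)"
  shows "topped_excess K (L @ [x]) (p @ [b]) (item_color x)
    \<le> Suc (topped_excess K L p (item_color x))"
proof -
  define T where "T = bins_topped L p (item_color x)"
  have "finite T" "b \<notin> T"
    using assms(2) by (simp_all add: T_def)
  moreover have "bins_topped (L @ [x]) (p @ [b]) (item_color x) = insert b T"
    using assms(1) by (simp add: T_def bins_topped_snoc)
  moreover have "set (p @ [b]) - insert b T - K = (set p - T - K) - {b}"
    by auto
  ultimately show ?thesis
    by (auto simp: topped_excess_def T_def[symmetric] card_Diff_singleton_if Int_insert_left)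
qed

lemma topped_excess_snoc_other_color:
  assumes "length p = length L" "b \<notin> bins_topped L p (item_color x)" "item_color x \<noteq> c"
    and "b \<in> K - set p \<Longrightarrow> set p \<inter> K \<subseteq> bins_topped L p (item_color x)"
  shows "topped_excess K (L @ [x]) (p @ [b]) c \<le> topped_excess K L p c - 1"
proof -
  define T where "T = bins_topped L p c"
  define T' where "T' = bins_topped (L @ [x]) (p @ [b]) c"
  have fin: "finite T"
    by (simp add: T_def)
  have T': "T' = T - {b}"
    using assms(1,3) by (simp add: T_def T'_def bins_topped_snoc)
  have topped: "b \<in> T" if "b \<in> set p"
    using that assms(2) bins_topped_Un_bins_topped[OF assms(3)] by (auto simp: T_def)
  have "card (T' \<inter> K) - card (set (p @ [b]) - T' - K) \<le> card (T \<inter> K) - card (set p - T - K) - 1"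
  proof -
    consider (reused) "b \<in> K" "b \<in> set p" | (opened) "b \<in> K" "b \<notin> set p" | (outside) "b \<notin> K"
      by blast
    then show ?thesis
    proof cases
      case reused
      then have "T' \<inter> K = (T \<inter> K) - {b}" "set (p @ [b]) - T' - K = set p - T - K"
        using T' by auto
      then show ?thesis using reused topped fin by simp
    next
      case opened
      then have "T' \<inter> K = {}"
        using T' assms(3,4) by (auto simp: T_def bins_topped_def)
      then show ?thesis by simp
    next
      case outside
      then have "T' \<inter> K = T \<inter> K" "set (p @ [b]) - T' - K = insert b (set p - T - K)"
        using T' by auto
      moreover have "b \<notin> set p - T - K"
        using topped by auto
      ultimately show ?thesis by simp
    qed
  qed
  then show ?thesis by (simp only: topped_excess_def T_def T'_def)
qed

definition monochromatic_openings :: "nat set \<Rightarrow> nat set \<Rightarrow> item list \<Rightarrow> nat list \<Rightarrow> bool" where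
  "monochromatic_openings K S L p \<longleftrightarrow>
     (\<forall>i < length p. p ! i \<in> K - set (take i p) \<longrightarrow>
        set (take i p) \<inter> S \<subseteq> bins_topped (take i L) (take i p) (item_color (L ! i)))"

lemma monochromatic_openings_snoc:
  "length p = length L \<Longrightarrow>
   monochromatic_openings K S (L @ [x]) (p @ [b]) \<longleftrightarrow>
     monochromatic_openings K S L p \<and>
     (b \<in> K - set p \<longrightarrow> set p \<inter> S \<subseteq> bins_topped L p (item_color x))"
  by (auto simp: monochromatic_openings_def All_less_Suc nth_append)

lemma topped_excess_le_surplus:
  assumes "alternating_packing L p" "monochromatic_openings K S L p" "K \<subseteq> S"
  shows "topped_excess K L p c \<le> surplus c L"
  using assms
proof (induction rule: alternating_packing.induct)
  case Nil
  then show ?case by (simp add: topped_excess_def bins_topped_def)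
next
  case (snoc L p b x)
  note len = alternating_packing_length[OF snoc.hyps(1)]
  have IH: "topped_excess K L p c \<le> surplus c L"
    using snoc len by (simp add: monochromatic_openings_snoc)
  show ?case
  proof (cases "item_color x = c")
    case True
    then show ?thesis
      using topped_excess_snoc_same_color[OF len snoc.hyps(2), of K] IH by simp
  next
    case False
    have "set p \<inter> K \<subseteq> bins_topped L p (item_color x)" if "b \<in> K - set p"
      using that snoc.prems len by (auto simp: monochromatic_openings_snoc)
    from topped_excess_snoc_other_color[OF len snoc.hyps(2) False this]
    show ?thesis using IH False by simp
  qed
qed

lemma card_monochromatic_openings_le:
  assumes "alternating_packing L p" "alternating_packing L q"
    and "monochromatic_openings K S L p" "K \<subseteq> S"
  shows "card (set p \<inter> K) \<le> num_bins q + card (set p - S)"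
  using assms
proof (induction arbitrary: q rule: alternating_packing.induct)
  case Nil
  then show ?case by simp
next
  case (snoc L p b x)
  note len = alternating_packing_length[OF snoc.hyps(1)]
  show ?case
  proof (cases "b \<in> K - set p")
    case True
    then have "set (p @ [b]) \<inter> S \<subseteq> bins_topped (L @ [x]) (p @ [b]) (item_color x)"
      using snoc.prems(2) len by (auto simp: monochromatic_openings_snoc bins_topped_snoc)
    then have "card (set (p @ [b]) \<inter> K)
        \<le> topped_excess K (L @ [x]) (p @ [b]) (item_color x) + card (set (p @ [b]) - S)"
      using snoc.prems(3) by (rule card_Int_le_topped_excess)
    moreover have "topped_excess K (L @ [x]) (p @ [b]) (item_color x)
        \<le> surplus (item_color x) (L @ [x])"
      using alternating_packing.snoc[OF snoc.hyps] snoc.prems(2,3) by (rule topped_excess_le_surplus)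
    moreover have "surplus (item_color x) (L @ [x]) \<le> num_bins q"
      using snoc.prems(1) by (rule surplus_le_num_bins)
    ultimately show ?thesis by linarith
  next
    case False
    obtain q' e where q: "q = q' @ [e]" "alternating_packing L q'"
      using snoc.prems(1) by (auto elim: alternating_packing_snocE)
    have "set (p @ [b]) \<inter> K = set p \<inter> K"
      using False by auto
    moreover have "card (set p \<inter> K) \<le> num_bins q' + card (set p - S)"
      using snoc q(2) len by (simp add: monochromatic_openings_snoc)
    moreover have "num_bins q' \<le> num_bins q"
      by (auto simp: q(1) num_bins_def intro: card_mono)
    moreover have "card (set p - S) \<le> card (set (p @ [b]) - S)"
      by (auto intro: card_mono)
    ultimately show ?thesis by simp
  qed
qed

section \<open>Any Fit packings\<close>

lemma any_fit_opening_topped: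
  assumes "any_fit A" "is_input (L @ [x])" "A (L @ [x]) \<notin> set (run A L)"
    and "b \<in> set (run A L)" "bin_load L (run A L) b + item_size x \<le> 1"
  shows "b \<in> bins_topped L (run A L) (item_color x)"
proof -
  have "\<not> can_add L (run A L) x b"
    using assms(1-4) unfolding any_fit_def Let_def by meson
  moreover have "valid_bin (bin_items L (run A L) b)"
    using any_fit_valid_packing[OF assms(1)] assms(2,4)
    by (auto simp: is_input_def valid_packing_def)
  ultimately show ?thesis
    using assms(4,5)
    by (auto simp: can_add_def valid_bin_def successively_append_iff bins_topped_def bin_load_def)
qed

lemma take_run: "take i (run A L) = run A (take i L)"
  by (auto simp: run_def take_map min_def)

lemma any_fit_monochromatic_openings:
  assumes "any_fit A" "is_input L"
  shows "monochromatic_openings {b. bin_load L (run A L) b \<le> t} {b. bin_load L (run A L) b \<le> 1 - t}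
    L (run A L)"
  unfolding monochromatic_openings_def
proof (intro allI impI subsetI)
  let ?p = "run A L"
  fix i b
  assume i: "i < length ?p" and small: "?p ! i \<in> {b. bin_load L ?p b \<le> t} - set (take i ?p)"
    and b: "b \<in> set (take i ?p) \<inter> {b. bin_load L ?p b \<le> 1 - t}"
  have prefix: "take (Suc i) L = take i L @ [L ! i]"
    using i by (simp add: take_Suc_conv_app_nth)
  have "is_input (take (Suc i) L)"
    using assms(2) by (auto simp: is_input_def dest: in_set_takeD)
  moreover have "A (take (Suc i) L) = ?p ! i"
    using i by (simp add: run_def)
  moreover have "bin_load (take i L) (take i ?p) b + item_size (L ! i) \<le> 1"
    using bin_load_take_le[OF assms(2), of ?p i b] item_size_le_bin_load[OF assms(2), of ?p i]
      i small b by simp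
  ultimately show "b \<in> bins_topped (take i L) (take i ?p) (item_color (L ! i))"
    using any_fit_opening_topped[OF assms(1), of "take i L" "L ! i" b] small b
    by (simp add: take_run prefix)
qed

lemma any_fit_card_light_bins_le:
  assumes "any_fit A" "is_input L" "valid_packing L q" "t \<le> 1/2"
  defines "p \<equiv> run A L"
  shows "card {b \<in> set p. bin_load L p b \<le> t}
    \<le> num_bins q + card {b \<in> set p. bin_load L p b > 1 - t}"
proof -
  let ?K = "{b. bin_load L p b \<le> t}" and ?S = "{b. bin_load L p b \<le> 1 - t}"
  have "card (set p \<inter> ?K) \<le> num_bins q + card (set p - ?S)"
  proof (rule card_monochromatic_openings_le)
    show "alternating_packing L p" "alternating_packing L q"
      using assms by (simp_all add: any_fit_valid_packing valid_packing_imp_alternating)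
    show "monochromatic_openings ?K ?S L p"
      unfolding p_def using assms(1,2) by (rule any_fit_monochromatic_openings)
    show "?K \<subseteq> ?S" using assms(4) by auto
  qed
  moreover have "set p \<inter> ?K = {b \<in> set p. bin_load L p b \<le> t}"
    and "set p - ?S = {b \<in> set p. bin_load L p b > 1 - t}" by auto
  ultimately show ?thesis by simp
qed

section \<open>Integrating over the threshold\<close>

lemma has_integral_step_function:
  fixes f :: "real \<Rightarrow> 'a::banach"
  assumes "a \<le> s" "s \<le> b"
    and "\<And>t. a \<le> t \<Longrightarrow> t < s \<Longrightarrow> f t = u" "\<And>t. s < t \<Longrightarrow> t \<le> b \<Longrightarrow> f t = v"
  shows "(f has_integral (s - a) *\<^sub>R u + (b - s) *\<^sub>R v) {a..b}"
  using assms(1,2)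
proof (rule has_integral_combine)
  show "(f has_integral (s - a) *\<^sub>R u) {a..s}"
    using has_integral_const_real[of u a s] assms(1,3)
    by (intro has_integral_spike_finite[of "{s}" _ f "\<lambda>_. u"]) auto
  show "(f has_integral (b - s) *\<^sub>R v) {s..b}"
    using has_integral_const_real[of v s b] assms(2,4)
    by (intro has_integral_spike_finite[of "{s}" _ f "\<lambda>_. v"]) auto
qed

lemma has_integral_threshold_difference:
  fixes y C :: real
  assumes "0 \<le> y" "0 \<le> C"
  obtains I where "C/2 - y \<le> I"
    and "((\<lambda>t. of_bool (y \<le> t) - of_bool (C - t < y)) has_integral I) {0..C/2}"
proof (cases "y \<le> C/2")
  case True
  then have "((\<lambda>t. of_bool (y \<le> t) - of_bool (C - t < y)) has_integral
      (y - 0) *\<^sub>R 0 + (C/2 - y) *\<^sub>R (1::real)) {0..C/2}"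
    using assms by (intro has_integral_step_function) auto
  then show ?thesis by (rule that[rotated]) simp
next
  case False
  then have "((\<lambda>t. of_bool (y \<le> t) - of_bool (C - t < y)) has_integral
      (max 0 (C - y) - 0) *\<^sub>R 0 + (C/2 - max 0 (C - y)) *\<^sub>R (-1::real)) {0..C/2}"
    using assms(2) by (intro has_integral_step_function) (auto simp: max_def split: if_splits)
  then show ?thesis by (rule that[rotated]) (use False assms(2) in \<open>simp add: max_def\<close>)
qed

lemma mult_card_le_twice_sum_plus:
  fixes f :: "'a \<Rightarrow> real" and C d :: real
  assumes "finite B" "0 \<le> C" "\<And>b. b \<in> B \<Longrightarrow> 0 \<le> f b"
    and card_threshold: "\<And>t. 0 \<le> t \<Longrightarrow> t \<le> C/2 \<Longrightarrow>
      card {b \<in> B. f b \<le> t} \<le> d + card {b \<in> B. f b > C - t}"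
  shows "C * card B \<le> 2 * sum f B + C * d"
proof -
  define g :: "'a \<Rightarrow> real \<Rightarrow> real" where
    "g b t = of_bool (f b \<le> t) - of_bool (C - t < f b)" for b t
  have "\<exists>I. C/2 - f b \<le> I \<and> (g b has_integral I) {0..C/2}" if "b \<in> B" for b
    using has_integral_threshold_difference[OF assms(3)[OF that] assms(2)] unfolding g_def by metis
  then obtain I where I: "\<And>b. b \<in> B \<Longrightarrow> C/2 - f b \<le> I b"
    and int: "\<And>b. b \<in> B \<Longrightarrow> (g b has_integral I b) {0..C/2}"
    by metis
  have "C * card B / 2 - sum f B = (\<Sum>b\<in>B. C/2 - f b)"
    by (simp add: sum_subtractf)
  also have "\<dots> \<le> (\<Sum>b\<in>B. I b)"
    using I by (rule sum_mono)
  also have "\<dots> \<le> C * d / 2"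
  proof (rule has_integral_le)
    show "((\<lambda>t. \<Sum>b\<in>B. g b t) has_integral (\<Sum>b\<in>B. I b)) {0..C/2}"
      using assms(1) int by (rule has_integral_sum)
    show "((\<lambda>_. d) has_integral C * d / 2) {0..C/2}"
      using has_integral_const_real[of d 0 "C/2"] assms(2) by simp
    show "(\<Sum>b\<in>B. g b t) \<le> d" if "t \<in> {0..C/2}" for t
    proof -
      have "(\<Sum>b\<in>B. g b t) = real (card {b \<in> B. f b \<le> t}) - real (card {b \<in> B. f b > C - t})"
        using assms(1) by (simp add: g_def sum_subtractf Int_def)
      then show ?thesis using card_threshold[of t] that by simp
    qed
  qed
  finally show ?thesis by simp
qed

theorem theorem5p1:
  fixes A :: online_algorithm
  assumes "any_fit A"
  shows "absolutely_competitive 3 A"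
  unfolding absolutely_competitive_def
proof (intro allI impI)
  fix L assume L: "is_input L"
  let ?p = "run A L"
  obtain q where q: "valid_packing L q" "num_bins q = OPT L"
    using OPT_attained[OF L] by blast
  have "1 * real (num_bins ?p) \<le> 2 * (\<Sum>b\<in>set ?p. bin_load L ?p b) + 1 * real (OPT L)"
    unfolding num_bins_def
  proof (rule mult_card_le_twice_sum_plus)
    show "real (card {b \<in> set ?p. bin_load L ?p b \<le> t})
        \<le> real (OPT L) + real (card {b \<in> set ?p. bin_load L ?p b > 1 - t})"
      if "t \<le> 1/2" for t
      using any_fit_card_light_bins_le[OF assms L q(1) that] q(2) by simp
  qed (simp_all add: bin_load_nonneg L)
  also have "(\<Sum>b\<in>set ?p. bin_load L ?p b) = total_size L"
    by (simp add: sum_bin_load)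
  also have "total_size L \<le> OPT L"
    using total_size_le_num_bins[OF q(1)] q(2) by simp
  finally show "real (num_bins ?p) \<le> 3 * real (OPT L)" by simp
qed

end
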